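(* For each $\alpha \in [0,1]$, the $\alpha$-level set $L_\alpha^* = \{ x \in [0,1] : \lambda^*(x) = \alpha \}$ of the convergence exponent $\lambda^*$ has box-counting dimension $1$.
   Context: Pierce digits. For $x \in [0,1]$, define $d_1(x) := \lfloor 1/x \rfloor$ and $T(x) := 1 - d_1(x)\,x$ if $x \neq 0$, and $d_1(0) := \infty$, $T(0) := 0$. Here $\lfloor y \rfloor$ is the largest integer not exceeding $y$. For $n \in \mathbb{N} = \{1,2,3,\dots\}$ put $d_n(x) := d_1(T^{n-1}(x))$, where $T^{n-1}$ is the $(n-1)$-fold iterate of $T$ ($T^0$ is the identity). The sequence $(d_n(x))_{n \in \mathbb{N}}$ is the Pierce expansion digit sequence of $x$. Conventions: $\infty^s := \infty$ for $s>0$ and $c/\infty := 0$ for $c \in \mathbb{R}$. Convergence exponent: for $x \in [0,1]$, $\lambda^*(x) := \inf\{ s > 0 : \sum_{n \in \mathbb{N}} 1/(d_n(x))^s \text{ converges} \}$. The function $\lambda^*$ takes values in $[0,1]$. The box-counting dimension of a non-empty set $F \subseteq [0,1]$ is $\lim_{\delta \to 0} \frac{\log N_\delta(F)}{-\log \delta}$, provided the limit exists, where $N_\delta(F)$ is the smallest number of sets of diameter not exceeding $\delta$ that cover $F$. *)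

theory Defs
  imports "HOL-Analysis.Analysis" "HOL-Library.Extended_Nat"
begin

definition pierce_d1 :: "real \<Rightarrow> enat" where
  "pierce_d1 x = (if x = 0 then \<infinity> else enat (nat \<lfloor>1 / x\<rfloor>))"

definition pierce_T :: "real \<Rightarrow> real" where
  "pierce_T x = (if x = 0 then 0 else 1 - of_int \<lfloor>1 / x\<rfloor> * x)"

(* Digits are indexed from 1; the value at index 0 is junk. *)
definition pierce_digit :: "nat \<Rightarrow> real \<Rightarrow> enat" where
  "pierce_digit n x = pierce_d1 ((pierce_T ^^ (n - 1)) x)"

(* 1 / d^s for s > 0, where infinity^s = infinity and 1 / infinity = 0.  The value is a real
   so that convergence of the series is a genuine condition: over ereal or ennreal every
   series of nonnegative terms is summable. *)
definition recip_powr :: "enat \<Rightarrow> real \<Rightarrow> real" where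
  "recip_powr d s = (case d of enat k \<Rightarrow> 1 / real k powr s | \<infinity> \<Rightarrow> 0)"

(* For x in [0,1] the finite digits are strictly increasing, so every s > 1 lies in this set:
   it is nonempty and bounded below, and the real infimum is the intended one. *)
definition conv_exponent :: "real \<Rightarrow> real" where
  "conv_exponent x = Inf {s. s > 0 \<and> summable (\<lambda>n. recip_powr (pierce_digit (Suc n) x) s)}"

definition conv_exponent_level :: "real \<Rightarrow> real set" where
  "conv_exponent_level \<alpha> = {x \<in> {0..1}. conv_exponent x = \<alpha>}"

(* Boundedness is required explicitly because diameter is a real-valued supremum, which is
   unspecified on unbounded sets. *)
definition covering_number :: "real \<Rightarrow> real set \<Rightarrow> nat" where
  "covering_number \<delta> F =
     (LEAST n. \<exists>\<C>. finite \<C> \<and> card \<C> = n \<and> F \<subseteq> \<Union>\<C> \<and> (\<forall>U\<in>\<C>. bounded U \<and> diameter U \<le> \<delta>))"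

(* The limit exists and equals D; used for nonempty subsets of [0,1] only. *)
definition has_box_dimension :: "real set \<Rightarrow> real \<Rightarrow> bool" where
  "has_box_dimension F D \<longleftrightarrow>
     F \<noteq> {} \<and> F \<subseteq> {0..1} \<and>
     ((\<lambda>\<delta>. ln (real (covering_number \<delta> F)) / - ln \<delta>) \<longlongrightarrow> D) (at_right 0)"

end

theory Submission
  imports Defs "HOL-Real_Asymp.Real_Asymp"
begin

text \<open>
  A subset of \<open>[0,1]\<close> that is dense in \<open>[0,1]\<close> has box-counting dimension 1, because passing to
  closures turns a finite cover of the set into a finite cover of the whole interval
  (\<open>dense_has_box_dimension_1\<close>).  So it suffices that every level set is dense.

  The convergence exponent is invariant under the Pierce map \<open>T\<close>, since applying \<open>T\<close> only drops
  the first digit.  On \<open>(1/(k+1), 1/k]\<close> the map \<open>T\<close> has the continuous inverse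
  \<open>z \<mapsto> (1 - z)/k\<close>, so approximability by points of the level set passes from \<open>T y\<close>
  to \<open>y\<close> (\<open>level_closure_pullback\<close>).  The orbit of a rational reaches 0 after finitely many steps,
  because \<open>T (p/q) = (q mod p)/q\<close> has a smaller numerator.  Hence all that remains is to approximate
  the single point 0 by points of the level set.

  For \<open>\<alpha> = 0\<close> the point 0 lies in the level set itself.  For \<open>\<alpha> > 0\<close> every strictly increasing
  sequence of integers \<open>\<ge> 2\<close> is the digit sequence of some point (\<open>pierce_expansion_exists\<close>),
  and the digits \<open>N + \<lfloor>n powr (1/\<alpha>)\<rfloor>\<close>, \<open>n \<ge> 1\<close>, are comparable to \<open>n powr (1/\<alpha>)\<close>, so by the
  p-series test their convergence exponent is \<open>\<alpha>\<close>; a large \<open>N\<close> makes the point as small as desired.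
\<close>

section \<open>Box dimension of dense subsets of the unit interval\<close>

text \<open>
  Each covering set lies in an interval of length \<open>2 * \<delta>\<close> about any of its points.  These
  intervals are closed and finitely many, so together they contain the closure of \<open>F\<close>, hence
  \<open>{0..1}\<close>, and the bound follows by comparing lengths.
\<close>

lemma dense_cover_card_ge:
  fixes F :: "real set"
  assumes dense: "{0..1} \<subseteq> closure F" and \<delta>: "\<delta> > 0"
    and fin: "finite \<C>" and cov: "F \<subseteq> \<Union>\<C>"
    and small: "\<And>U. U \<in> \<C> \<Longrightarrow> bounded U \<and> diameter U \<le> \<delta>"
  shows "1 / (2 * \<delta>) \<le> real (card \<C>)"
proof -
  have "\<exists>c. U \<subseteq> {c - \<delta>..c + \<delta>}" if "U \<in> \<C>" for U
  proof (cases "U = {}")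
    case False
    then obtain u where u: "u \<in> U" by blast
    have "dist x u \<le> \<delta>" if "x \<in> U" for x
      using small[OF \<open>U \<in> \<C>\<close>] diameter_bounded_bound[OF _ that u] by force
    then show ?thesis
      by (intro exI[of _ u]) (force simp: dist_real_def abs_le_iff)
  qed auto
  then obtain c where c: "\<And>U. U \<in> \<C> \<Longrightarrow> U \<subseteq> {c U - \<delta>..c U + \<delta>}"
    by metis
  have "F \<subseteq> (\<Union>U\<in>\<C>. {c U - \<delta>..c U + \<delta>})"
    using cov c by blast
  moreover have "closed (\<Union>U\<in>\<C>. {c U - \<delta>..c U + \<delta>})"
    using fin by auto
  ultimately have sub: "{0..1} \<subseteq> (\<Union>U\<in>\<C>. {c U - \<delta>..c U + \<delta>})"
    using dense closure_minimal by blast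
  have "1 = measure lborel {0..1::real}"
    by simp
  also have "\<dots> \<le> measure lborel (\<Union>U\<in>\<C>. {c U - \<delta>..c U + \<delta>})"
    using fin by (intro measure_mono_fmeasurable[OF sub] fmeasurable.finite_UN fmeasurableI)
      (auto simp: emeasure_lborel_Icc_eq)
  also have "\<dots> \<le> (\<Sum>U\<in>\<C>. measure lborel {c U - \<delta>..c U + \<delta>})"
    using fin by (intro measure_UNION_le) auto
  also have "\<dots> = real (card \<C>) * (2 * \<delta>)"
    using \<delta> by simp
  finally show ?thesis
    using \<delta> by (simp add: field_simps)
qed

lemma unit_interval_cover_exists:
  fixes F :: "real set"
  assumes F: "F \<subseteq> {0..1}" and \<delta>: "\<delta> > 0"
  shows "\<exists>\<C>. finite \<C> \<and> real (card \<C>) \<le> 1 / \<delta> + 1 \<and> F \<subseteq> \<Union>\<C>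
           \<and> (\<forall>U\<in>\<C>. bounded U \<and> diameter U \<le> \<delta>)"
proof -
  define m where "m = nat \<lfloor>1 / \<delta>\<rfloor>"
  define \<C> where "\<C> = (\<lambda>j. {real j * \<delta>..real j * \<delta> + \<delta>}) ` {..m}"
  have "card \<C> \<le> m + 1"
    unfolding \<C>_def using card_image_le[of "{..m}"] by fastforce
  moreover have "real m \<le> 1 / \<delta>"
    unfolding m_def using \<delta> by simp
  ultimately have card: "real (card \<C>) \<le> 1 / \<delta> + 1"
    by linarith
  have "x \<in> \<Union>\<C>" if "x \<in> F" for x
  proof -
    define j where "j = nat \<lfloor>x / \<delta>\<rfloor>"
    have x: "0 \<le> x" "x \<le> 1" using F that by auto
    have "real j \<le> x / \<delta>" "x / \<delta> \<le> real j + 1"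
      unfolding j_def using x \<delta> by auto
    then have "x \<in> {real j * \<delta>..real j * \<delta> + \<delta>}"
      using \<delta> by (auto simp: field_simps)
    moreover have "j \<le> m"
      unfolding j_def m_def using x \<delta> by (intro nat_mono floor_mono divide_right_mono) auto
    ultimately show ?thesis
      unfolding \<C>_def by blast
  qed
  moreover have "bounded U \<and> diameter U \<le> \<delta>" if "U \<in> \<C>" for U
    using that \<delta> unfolding \<C>_def by (auto simp: diameter_closed_interval)
  ultimately show ?thesis
    using card unfolding \<C>_def by blast
qed

lemma dense_has_box_dimension_1:
  assumes F: "F \<subseteq> {0..1}" and dense: "{0..1} \<subseteq> closure F"
  shows "has_box_dimension F 1"
proof -
  have bounds: "1 / (2 * \<delta>) \<le> real (covering_number \<delta> F)"
    "real (covering_number \<delta> F) \<le> 1 / \<delta> + 1" if \<delta>: "\<delta> > 0" for \<delta>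
  proof -
    let ?P = "\<lambda>n. \<exists>\<C>. finite \<C> \<and> card \<C> = n \<and> F \<subseteq> \<Union>\<C>
                     \<and> (\<forall>U\<in>\<C>. bounded U \<and> diameter U \<le> \<delta>)"
    obtain \<C> where C: "finite \<C>" "real (card \<C>) \<le> 1 / \<delta> + 1" "F \<subseteq> \<Union>\<C>"
      "\<forall>U\<in>\<C>. bounded U \<and> diameter U \<le> \<delta>"
      using unit_interval_cover_exists[OF F \<delta>] by blast
    then have P: "?P (card \<C>)" by blast
    have "?P (covering_number \<delta> F)"
      unfolding covering_number_def by (rule LeastI[of ?P, OF P])
    then show "1 / (2 * \<delta>) \<le> real (covering_number \<delta> F)"
      using dense_cover_card_ge[OF dense \<delta>] by metis
    have "covering_number \<delta> F \<le> card \<C>"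
      unfolding covering_number_def by (rule Least_le[of ?P, OF P])
    then show "real (covering_number \<delta> F) \<le> 1 / \<delta> + 1"
      using C(2) by linarith
  qed
  have small: "\<forall>\<^sub>F \<delta>::real in at_right 0. 0 < \<delta> \<and> \<delta> < 1"
    unfolding eventually_at_right_field by (intro exI[of _ 1]) auto
  have "((\<lambda>\<delta>. ln (real (covering_number \<delta> F)) / - ln \<delta>) \<longlongrightarrow> 1) (at_right 0)"
  proof (rule tendsto_sandwich)
    show "\<forall>\<^sub>F \<delta> in at_right 0. ln (1 / (2 * \<delta>)) / - ln \<delta> \<le> ln (real (covering_number \<delta> F)) / - ln \<delta>"
      using small
    proof eventually_elim
      case (elim \<delta>)
      then have "0 < 1 / (2 * \<delta>)" by simp
      then have "ln (1 / (2 * \<delta>)) \<le> ln (real (covering_number \<delta> F))"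
        using bounds(1)[of \<delta>] elim by (subst ln_le_cancel_iff) linarith+
      then show ?case
        using elim by (intro divide_right_mono) auto
    qed
    show "\<forall>\<^sub>F \<delta> in at_right 0. ln (real (covering_number \<delta> F)) / - ln \<delta> \<le> ln (1 / \<delta> + 1) / - ln \<delta>"
      using small
    proof eventually_elim
      case (elim \<delta>)
      then have "0 < 1 / (2 * \<delta>)" by simp
      then have "ln (real (covering_number \<delta> F)) \<le> ln (1 / \<delta> + 1)"
        using bounds[of \<delta>] elim by (subst ln_le_cancel_iff) linarith+
      then show ?case
        using elim by (intro divide_right_mono) auto
    qed
    show "((\<lambda>\<delta>::real. ln (1 / (2 * \<delta>)) / - ln \<delta>) \<longlongrightarrow> 1) (at_right 0)"
      by real_asymp
    show "((\<lambda>\<delta>::real. ln (1 / \<delta> + 1) / - ln \<delta>) \<longlongrightarrow> 1) (at_right 0)"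
      by real_asymp
  qed
  moreover have "F \<noteq> {}"
    using dense by auto
  ultimately show ?thesis
    using F unfolding has_box_dimension_def by blast
qed

section \<open>Inverse branches of the Pierce map\<close>

lemma pierce_inverse_branch:
  fixes z :: real and k :: nat
  assumes k: "k \<ge> 1" and z: "0 \<le> z" "z < 1 / (real k + 1)"
  defines "y \<equiv> (1 - z) / real k"
  shows "0 < y" "y \<le> 1" "\<lfloor>1 / y\<rfloor> = int k" "pierce_T y = z"
proof -
  have "1 / (real k + 1) < 1" using k by simp
  then have z1: "z < 1" using z by linarith
  show y0: "0 < y"
    using z1 k by (simp add: y_def)
  have "1 - z \<le> real k" using z k by linarith
  then show "y \<le> 1"
    using k by (simp add: y_def field_simps)
  have "real k * (1 - z) \<le> real k"
    using z k by (simp add: algebra_simps)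
  moreover have "real k < (real k + 1) * (1 - z)"
    using z k by (simp add: field_simps)
  ultimately show fl: "\<lfloor>1 / y\<rfloor> = int k"
    using z1 k by (intro floor_unique) (auto simp: y_def field_simps)
  show "pierce_T y = z"
    using y0 z1 k unfolding pierce_T_def fl by (simp add: y_def)
qed

lemma conv_exponent_pierce_T: "conv_exponent (pierce_T x) = conv_exponent x"
proof -
  have "pierce_digit (Suc n) (pierce_T x) = pierce_digit (Suc (Suc n)) x" for n
    by (simp add: pierce_digit_def funpow_swap1)
  then show ?thesis
    unfolding conv_exponent_def
    by (simp add: summable_Suc_iff[of "\<lambda>n. recip_powr (pierce_digit (Suc n) x) s" for s])
qed

text \<open>
  The inverse branch \<open>z \<mapsto> (1 - z)/k\<close> of the Pierce map that belongs to the first digit \<open>k\<close> of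
  \<open>y\<close> is defined on \<open>[0, 1/(k+1))\<close>.  This is a relative neighbourhood of \<open>T y\<close> in \<open>[0,1]\<close>, so the
  branch carries a sequence of the level set that converges to \<open>T y\<close> to one that converges to \<open>y\<close>.
\<close>

lemma level_closure_pullback:
  assumes y: "0 < y" "y \<le> 1" and cl: "pierce_T y \<in> closure (conv_exponent_level \<alpha>)"
  shows "y \<in> closure (conv_exponent_level \<alpha>)"
proof -
  define k where "k = nat \<lfloor>1 / y\<rfloor>"
  have "1 \<le> \<lfloor>1 / y\<rfloor>"
    using y by simp
  then have k: "k \<ge> 1" and ik: "int k = \<lfloor>1 / y\<rfloor>"
    unfolding k_def by linarith+
  have T: "pierce_T y = 1 - real k * y"
    using y unfolding pierce_T_def ik[symmetric] by simp
  have "1 / y < real k + 1"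
    using ik by linarith
  then have "1 < (real k + 1) * y"
    using y by (simp add: field_simps)
  then have "real k * 1 < real k * ((real k + 1) * y)"
    using k by (intro mult_strict_left_mono) auto
  then have "(1 - real k * y) * (real k + 1) < 1"
    by (simp add: algebra_simps)
  then have Tlt: "pierce_T y < 1 / (real k + 1)"
    unfolding T by (subst pos_less_divide_eq) auto
  obtain z where z: "\<And>n. z n \<in> conv_exponent_level \<alpha>" "z \<longlonglongrightarrow> pierce_T y"
    using cl unfolding closure_sequential by blast
  have lim: "(\<lambda>n. (1 - z n) / real k) \<longlonglongrightarrow> y"
  proof -
    have "(\<lambda>n. (1 - z n) / real k) \<longlonglongrightarrow> (1 - pierce_T y) / real k"
      using k by (intro tendsto_intros z) auto
    then show ?thesis using k by (simp add: T)
  qed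
  have "\<forall>\<^sub>F n in sequentially. z n < 1 / (real k + 1)"
    using order_tendstoD(2)[OF z(2) Tlt] .
  then have "\<forall>\<^sub>F n in sequentially. (1 - z n) / real k \<in> conv_exponent_level \<alpha>"
  proof eventually_elim
    case (elim n)
    have zn: "0 \<le> z n" "conv_exponent (z n) = \<alpha>"
      using z(1)[of n] by (auto simp: conv_exponent_level_def)
    note br = pierce_inverse_branch[OF k zn(1) elim]
    show ?case
      using br(1,2) zn(2) conv_exponent_pierce_T[of "(1 - z n) / real k"]
      unfolding br(4) conv_exponent_level_def by auto
  qed
  then have "\<forall>\<^sub>F n in sequentially. (1 - z n) / real k \<in> closure (conv_exponent_level \<alpha>)"
    by eventually_elim (use closure_subset in blast)
  then show ?thesis
    using Lim_in_closed_set[OF closed_closure _ _ lim] by simp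
qed

text \<open>
  The Pierce map sends \<open>p/q\<close> to \<open>(q mod p)/q\<close>, so the numerators decrease along the orbit of a
  rational until it reaches 0.
\<close>

lemma rational_in_level_closure:
  assumes zero: "0 \<in> closure (conv_exponent_level \<alpha>)" and "p \<le> q"
  shows "real p / real q \<in> closure (conv_exponent_level \<alpha>)"
  using \<open>p \<le> q\<close>
proof (induction p rule: less_induct)
  case (less p)
  show ?case
  proof (cases "p = 0")
    case False
    then have p: "p > 0" and q: "q > 0" using less.prems by auto
    have "real q = real (q div p) * real p + real (q mod p)"
      by (metis div_mult_mod_eq of_nat_add of_nat_mult)
    then have "1 - real (q div p) * (real p / real q) = real (q mod p) / real q"
      using q by (simp add: divide_simps)
    then have "pierce_T (real p / real q) = real (q mod p) / real q"
      using p q by (simp add: pierce_T_def floor_divide_of_nat_eq)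
    moreover have "q mod p < p" using p by simp
    moreover have "q mod p \<le> q" by simp
    ultimately have "pierce_T (real p / real q) \<in> closure (conv_exponent_level \<alpha>)"
      using less.IH by simp
    then show ?thesis
      using p q less.prems by (intro level_closure_pullback[of "real p / real q"]) auto
  qed (use zero in simp)
qed

lemma level_dense_if_zero_in_closure:
  assumes zero: "0 \<in> closure (conv_exponent_level \<alpha>)"
  shows "{0..1} \<subseteq> closure (conv_exponent_level \<alpha>)"
proof
  fix x :: real
  assume x: "x \<in> {0..1}"
  define r where "r n = real (nat \<lfloor>real (Suc n) * x\<rfloor>) / real (Suc n)" for n
  have "r n \<in> closure (conv_exponent_level \<alpha>)" for n
  proof -
    have "real (Suc n) * x \<le> real (Suc n)"
      using x by (intro mult_left_le) auto
    then have "nat \<lfloor>real (Suc n) * x\<rfloor> \<le> Suc n"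
      by linarith
    then show ?thesis
      unfolding r_def by (intro rational_in_level_closure[OF zero])
  qed
  moreover have "r \<longlonglongrightarrow> x"
  proof (rule tendsto_sandwich)
    have fl: "real (nat \<lfloor>real (Suc n) * x\<rfloor>) \<le> real (Suc n) * x"
      "real (Suc n) * x - 1 \<le> real (nat \<lfloor>real (Suc n) * x\<rfloor>)" for n
    proof -
      have "0 \<le> real (Suc n) * x" using x by simp
      then show "real (nat \<lfloor>real (Suc n) * x\<rfloor>) \<le> real (Suc n) * x"
        "real (Suc n) * x - 1 \<le> real (nat \<lfloor>real (Suc n) * x\<rfloor>)" by linarith+
    qed
    show "\<forall>\<^sub>F n in sequentially. r n \<le> x"
      using fl(1) unfolding r_def
      by (intro always_eventually allI) (simp add: divide_le_eq mult.commute del: of_nat_Suc)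
    have "x - 1 / real (Suc n) \<le> r n" for n
    proof -
      have "x - 1 / real (Suc n) = (real (Suc n) * x - 1) / real (Suc n)"
        by (simp add: field_simps)
      also have "\<dots> \<le> r n"
        unfolding r_def using fl(2) by (intro divide_right_mono) auto
      finally show ?thesis .
    qed
    then show "\<forall>\<^sub>F n in sequentially. x - 1 / real (Suc n) \<le> r n"
      by simp
    show "(\<lambda>n. x - 1 / real (Suc n)) \<longlonglongrightarrow> x"
      by real_asymp
  qed simp
  ultimately show "x \<in> closure (conv_exponent_level \<alpha>)"
    using Lim_in_closed_set[OF closed_closure] by (metis always_eventually sequentially_bot)
qed

section \<open>Points with prescribed digits\<close>

text \<open>
  The point is the alternating series of the reciprocals of \<open>d 0 * \<dots> * d j\<close>.  Let \<open>t m\<close> be the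
  same series for the digits from index \<open>m\<close> on.  Splitting off the first term gives
  \<open>t m = (1 - t (m + 1)) / d m\<close>, which is the inverse branch of digit \<open>d m\<close> at \<open>t (m + 1)\<close>;
  strict growth of the digits is what puts \<open>t (m + 1)\<close> into the domain \<open>[0, 1/(d m + 1))\<close> of that
  branch.  So \<open>t\<close> is the orbit of \<open>t 0\<close>.
\<close>

lemma pierce_expansion_exists:
  fixes d :: "nat \<Rightarrow> nat"
  assumes d2: "\<And>n. d n \<ge> 2" and mono: "\<And>n. d n < d (Suc n)"
  shows "\<exists>x. 0 < x \<and> x \<le> 1 / real (d 0) \<and> (\<forall>n. pierce_digit (Suc n) x = enat (d n))"
proof -
  define f where "f m j = (-1) ^ j / (\<Prod>i\<le>j. real (d (m + i)))" for m j
  define t where "t m = (\<Sum>j. f m j)" for m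
  have dpos: "real (d n) > 0" for n
    using d2[of n] by linarith
  have fle: "norm (f m j) \<le> (1 / 2) ^ Suc j" for m j
  proof -
    have "(\<Prod>i\<le>j. 2::real) \<le> (\<Prod>i\<le>j. real (d (m + i)))"
      using d2 by (intro prod_mono) (auto simp: numeral_le_real_of_nat_iff)
    then have "2 ^ Suc j \<le> (\<Prod>i\<le>j. real (d (m + i)))"
      by simp
    then have "1 / (\<Prod>i\<le>j. real (d (m + i))) \<le> 1 / 2 ^ Suc j"
      by (intro divide_left_mono mult_pos_pos prod_pos dpos) auto
    moreover have "norm (f m j) = 1 / (\<Prod>i\<le>j. real (d (m + i)))"
      unfolding f_def by (simp add: abs_prod power_abs)
    ultimately show ?thesis
      by (simp add: power_one_over)
  qed
  have summ: "summable (f m)" for m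
    using fle by (intro summable_comparison_test[OF _ sums_summable[OF power_half_series]]) auto
  have rec: "t m = (1 - t (Suc m)) / real (d m)" for m
  proof -
    have "f m (Suc j) = - (1 / real (d m)) * f (Suc m) j" for j
      unfolding f_def by (subst prod.atMost_Suc_shift) simp
    then have "(\<Sum>j. f m (Suc j)) = - (1 / real (d m)) * t (Suc m)"
      unfolding t_def by (simp add: suminf_mult summ suminf_minus suminf_divide)
    then have "t m - f m 0 = - (1 / real (d m)) * t (Suc m)"
      using suminf_split_head[OF summ[of m]] unfolding t_def by simp
    then show ?thesis
      by (simp add: f_def diff_divide_distrib)
  qed
  (* Only the trivial bound t \<le> 1 comes from the series; the recursion then gives in turn t \<ge> 0,
     t \<le> 1/d, and t > 0. *)
  have t1: "t m \<le> 1" for m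
  proof -
    have "t m \<le> (\<Sum>j. (1 / 2) ^ Suc j)"
      unfolding t_def using fle[of m] summ sums_summable[OF power_half_series]
      by (intro suminf_le) (auto simp: abs_le_iff simp del: power_Suc)
    also have "\<dots> = 1"
      using power_half_series by (rule sums_unique[symmetric])
    finally show ?thesis .
  qed
  have t0: "t m \<ge> 0" for m
    using t1[of "Suc m"] by (subst rec) simp
  have tle: "t m \<le> 1 / real (d m)" for m
    using t0[of "Suc m"] dpos by (subst rec) (intro divide_right_mono, auto)
  have tpos: "t m > 0" for m
  proof -
    have "1 / real (d (Suc m)) < 1" using d2[of "Suc m"] by simp
    then have "t (Suc m) < 1"
      using tle[of "Suc m"] by linarith
    then show ?thesis
      using dpos by (subst rec) simp
  qed
  have tlt: "t (Suc m) < 1 / (real (d m) + 1)" for m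
  proof -
    have "t (Suc m) < 1 / real (d (Suc m))"
      using tpos[of "Suc (Suc m)"] dpos by (subst rec) (intro divide_strict_right_mono, auto)
    also have "\<dots> \<le> 1 / (real (d m) + 1)"
      using mono[of m] by (intro divide_left_mono mult_pos_pos dpos) auto
    finally show ?thesis .
  qed
  have "d m \<ge> 1" for m
    using d2[of m] by linarith
  note br = pierce_inverse_branch[OF this t0 tlt, folded rec]
  have orbit: "(pierce_T ^^ n) (t 0) = t n" for n
    by (induction n) (auto simp: br(4))
  have "pierce_digit (Suc n) (t 0) = enat (d n)" for n
    using tpos[of n] by (simp add: pierce_digit_def orbit pierce_d1_def br(3))
  then show ?thesis
    using tpos tle by blast
qed

text \<open>
  Gaps of at least 1 make the integer parts of \<open>n powr b\<close> strictly increasing, so that they can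
  serve as digits; this is where \<open>\<alpha> \<le> 1\<close> enters, through \<open>b = 1/\<alpha> \<ge> 1\<close>.
\<close>

lemma powr_succ_ge:
  fixes a b :: real
  assumes "b \<ge> 1" "a \<ge> 1"
  shows "a powr b + 1 \<le> (a + 1) powr b"
proof -
  have "a powr b + 1 \<le> a * a powr (b - 1) + 1 * a powr (b - 1)"
    using assms ge_one_powr_ge_zero[of a "b - 1"] by (simp add: powr_diff)
  also have "\<dots> = (a + 1) * a powr (b - 1)"
    by (simp add: algebra_simps)
  also have "\<dots> \<le> (a + 1) * (a + 1) powr (b - 1)"
    using assms by (intro mult_left_mono powr_mono2) auto
  also have "\<dots> = (a + 1) powr b"
    using assms by (simp add: powr_diff)
  finally show ?thesis .
qed

lemma conv_exponent_eqI:
  assumes "a \<ge> 0"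
    and "\<And>s. s > 0 \<Longrightarrow> summable (\<lambda>n. recip_powr (pierce_digit (Suc n) x) s) \<longleftrightarrow> s > a"
  shows "conv_exponent x = a"
proof -
  have "{s. s > 0 \<and> summable (\<lambda>n. recip_powr (pierce_digit (Suc n) x) s)} = {a<..}"
    using assms by force
  then show ?thesis
    by (simp add: conv_exponent_def)
qed

lemma small_point_in_level:
  fixes \<alpha> :: real and N :: nat
  assumes \<alpha>: "0 < \<alpha>" "\<alpha> \<le> 1" and N: "N \<ge> 1"
  shows "\<exists>x \<in> conv_exponent_level \<alpha>. 0 < x \<and> x \<le> 1 / real N"
proof -
  define b where "b = 1 / \<alpha>"
  have b: "b \<ge> 1" using \<alpha> by (simp add: b_def)
  define p where "p n = real (Suc n) powr b" for n
  define d where "d n = N + nat \<lfloor>p n\<rfloor>" for n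
  have p1: "p n \<ge> 1" for n
    unfolding p_def using b by (intro ge_one_powr_ge_zero) auto
  have pS: "p n + 1 \<le> p (Suc n)" for n
    using powr_succ_ge[OF b, of "real (Suc n)"] by (simp add: p_def add_ac)
  have d2: "d n \<ge> 2" for n
    using p1[of n] N unfolding d_def by linarith
  have mono: "d n < d (Suc n)" for n
    using pS[of n] p1[of n] unfolding d_def by linarith
  obtain x where x: "0 < x" "x \<le> 1 / real (d 0)" "\<And>n. pierce_digit (Suc n) x = enat (d n)"
    using pierce_expansion_exists[of d] d2 mono by blast
  have "1 / real (d 0) \<le> 1 / real N"
    using N by (intro divide_left_mono) (auto simp: d_def)
  then have xN: "x \<le> 1 / real N"
    using x by linarith
  have dge: "p n \<le> real (d n)" for n
    using N p1[of n] unfolding d_def by linarith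
  have dle: "real (d n) \<le> (real N + 1) * p n" for n
  proof -
    have "real N * 1 \<le> real N * p n"
      using p1[of n] by (intro mult_left_mono) auto
    moreover have "real (nat \<lfloor>p n\<rfloor>) \<le> p n"
      using p1[of n] by linarith
    ultimately show ?thesis
      by (simp add: d_def algebra_simps)
  qed
  have pser: "summable (\<lambda>n. 1 / p n powr s) \<longleftrightarrow> s > \<alpha>" if "s > 0" for s
  proof -
    have eq: "1 / p n powr s = real (Suc n) powr (- (b * s))" for n
      by (simp add: p_def powr_powr powr_minus_divide del: of_nat_Suc)
    have "summable (\<lambda>n. 1 / p n powr s) \<longleftrightarrow> summable (\<lambda>n. real n powr (- (b * s)))"
      unfolding eq by (rule summable_Suc_iff)
    also have "\<dots> \<longleftrightarrow> b * s > 1"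
      by (subst summable_real_powr_iff) auto
    also have "\<dots> \<longleftrightarrow> s > \<alpha>"
      using \<alpha> by (simp add: b_def field_simps)
    finally show ?thesis .
  qed
  have "summable (\<lambda>n. recip_powr (pierce_digit (Suc n) x) s) \<longleftrightarrow> s > \<alpha>" if s: "s > 0" for s
  proof -
    have pp: "p n > 0" "real (d n) > 0" for n
      using p1[of n] d2[of n] by linarith+
    have upper: "1 / real (d n) powr s \<le> 1 / p n powr s" for n
      using dge[of n] s pp[of n] by (intro divide_left_mono powr_mono2 mult_pos_pos) auto
    have lower: "1 / p n powr s \<le> (real N + 1) powr s * (1 / real (d n) powr s)" for n
    proof -
      have "real (d n) powr s \<le> ((real N + 1) * p n) powr s"
        using dle[of n] s pp[of n] by (intro powr_mono2) auto
      also have "\<dots> = (real N + 1) powr s * p n powr s"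
        using pp[of n] by (simp add: powr_mult)
      finally show ?thesis
        using pp[of n] by (simp add: field_simps)
    qed
    have "summable (\<lambda>n. 1 / real (d n) powr s) \<longleftrightarrow> summable (\<lambda>n. 1 / p n powr s)"
    proof
      assume "summable (\<lambda>n. 1 / real (d n) powr s)"
      then have "summable (\<lambda>n. (real N + 1) powr s * (1 / real (d n) powr s))"
        by (rule summable_mult)
      then show "summable (\<lambda>n. 1 / p n powr s)"
        by (rule summable_comparison_test') (use lower in auto)
    next
      assume "summable (\<lambda>n. 1 / p n powr s)"
      then show "summable (\<lambda>n. 1 / real (d n) powr s)"
        by (rule summable_comparison_test') (use upper in auto)
    qed
    then show ?thesis
      using pser[OF s] by (simp add: x(3) recip_powr_def)
  qed
  then have "conv_exponent x = \<alpha>"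
    using \<alpha> by (intro conv_exponent_eqI) auto
  moreover have "1 / real N \<le> 1" using N by simp
  ultimately have "x \<in> conv_exponent_level \<alpha>"
    using x(1) xN unfolding conv_exponent_level_def by auto
  then show ?thesis
    using x(1) xN by blast
qed

lemma zero_in_level_closure:
  assumes "\<alpha> \<in> {0..1}"
  shows "0 \<in> closure (conv_exponent_level \<alpha>)"
proof (cases "\<alpha> = 0")
  case True
  have "(pierce_T ^^ n) 0 = 0" for n
    by (induction n) (auto simp: pierce_T_def)
  then have "conv_exponent 0 = 0"
    by (intro conv_exponent_eqI) (auto simp: pierce_digit_def pierce_d1_def recip_powr_def)
  then have "0 \<in> conv_exponent_level \<alpha>"
    using True by (simp add: conv_exponent_level_def)
  then show ?thesis
    using closure_subset by blast
next
  case False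
  have "\<exists>x \<in> conv_exponent_level \<alpha>. dist x 0 < e" if "e > 0" for e
  proof -
    obtain n where "1 / real (Suc n) < e"
      using nat_approx_posE[OF \<open>e > 0\<close>] by auto
    then show ?thesis
      using small_point_in_level[of \<alpha> "Suc n"] assms False by force
  qed
  then show ?thesis
    unfolding closure_approachable by blast
qed

theorem corollary1p9:
  fixes \<alpha> :: real
  assumes "\<alpha> \<in> {0..1}"
  shows "has_box_dimension (conv_exponent_level \<alpha>) 1"
proof (rule dense_has_box_dimension_1)
  show "conv_exponent_level \<alpha> \<subseteq> {0..1}"
    by (auto simp: conv_exponent_level_def)
  show "{0..1} \<subseteq> closure (conv_exponent_level \<alpha>)"
    using assms by (intro level_dense_if_zero_in_closure zero_in_level_closure)
qed

end
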